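(* Let $G$ be an undirected graph with $N\ge 2$ vertices and let $G^c$ be its complement graph. Then: (a) $\mathbb{E}(H_{G^c})=N-1-\mathbb{E}(H_G)$; (b) $\mathbb{V}(H_{G^c})=\mathbb{V}(H_G)+1-\dfrac{2\,\mathbb{E}(H_G)}{N-1}$.
   Context: Graphs are finite, undirected and without loops (and without multiple edges), with vertices labelled $1,\dots,N$. The adjacency matrix $A_G$ of $G=(V,E)$ is the symmetric $N\times N$ matrix with $(A_G)_{i,j}=1$ if $(i,j)\in E$ and $0$ otherwise; its diagonal entries are zero. The complement graph $G^c$ of $G=(V,E)$ is the graph on the same vertex set $V$ with edge set $(V^2\setminus\Delta)\setminus E$, where $\Delta=\{(v,v): v\in V\}$ (so $G^c$ also has no loops). For $0\le k\le N$, $h_G(k)$ is the number of permutations $\pi$ of $\{1,\dots,N\}$ such that $\sum_{i=1}^N (A_G)_{i,\pi(i)}=k$. The mp-chart of $G$ is the vector $H_G=(h_G(0),\dots,h_G(N))$. Normalized by $N!$, it is the probability distribution of $\sum_{i=1}^N (A_G)_{i,\pi(i)}$ for $\pi$ a uniformly random permutation; $\mathbb{E}(H_G)$ and $\mathbb{V}(H_G)$ denote the mean and the variance of this distribution. *)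

theory Defs
  imports "HOL-Probability.Probability" "Graph_Theory.Pair_Digraph"
begin

(* A finite undirected simple graph is a "pair_graph": a finite loop-free digraph whose arc set is
   a symmetric relation on the vertices, so that an undirected edge {i,j} is the two pairs
   (i,j) and (j,i). *)

definition graph_complement :: "'a pair_pre_digraph \<Rightarrow> 'a pair_pre_digraph" where
  "graph_complement G =
     \<lparr> pverts = pverts G, parcs = (pverts G \<times> pverts G - Id_on (pverts G)) - parcs G \<rparr>"

definition adj_mat :: "'a pair_pre_digraph \<Rightarrow> 'a \<Rightarrow> 'a \<Rightarrow> nat" where
  "adj_mat G i j = (if (i, j) \<in> parcs G then 1 else 0)"

definition mp_count :: "'a pair_pre_digraph \<Rightarrow> nat \<Rightarrow> nat" where
  "mp_count G k = card {\<pi>. \<pi> permutes pverts G \<and> (\<Sum>i\<in>pverts G. adj_mat G i (\<pi> i)) = k}"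

(* The vector (h_G(0), ..., h_G(N)) as a list of length N + 1, where N is the number of vertices. *)
definition mp_chart :: "'a pair_pre_digraph \<Rightarrow> nat list" where
  "mp_chart G = map (mp_count G) [0..<card (pverts G) + 1]"

(* The chart of a graph on N vertices has length N + 1, so the normalizing factor is
   fact (length H - 1).  "embed_pmf" is only specified for weights that sum to 1; for charts
   this is the content of pmf_chart_pmf below. *)
definition chart_pmf :: "nat list \<Rightarrow> nat pmf" where
  "chart_pmf H =
     embed_pmf (\<lambda>k. if k < length H then real (H ! k) / fact (length H - 1) else 0)"

definition chart_mean :: "nat list \<Rightarrow> real" where
  "chart_mean H = measure_pmf.expectation (chart_pmf H) real"

definition chart_variance :: "nat list \<Rightarrow> real" where
  "chart_variance H = measure_pmf.variance (chart_pmf H) real"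

lemma adj_mat_sum_le:
  assumes "finite (pverts G)"
  shows "(\<Sum>i\<in>pverts G. adj_mat G i (\<pi> i)) \<le> card (pverts G)"
proof -
  have "(\<Sum>i\<in>pverts G. adj_mat G i (\<pi> i)) \<le> (\<Sum>i\<in>pverts G. 1)"
    by (intro sum_mono) (auto simp: adj_mat_def)
  then show ?thesis by simp
qed

lemma chart_pmf_eq_map_pmf:
  assumes fin: "finite (pverts G)"
  shows "chart_pmf (mp_chart G) =
    map_pmf (\<lambda>\<pi>. \<Sum>i\<in>pverts G. adj_mat G i (\<pi> i)) (pmf_of_set {\<pi>. \<pi> permutes pverts G})"
    (is "_ = map_pmf ?X (pmf_of_set ?P)")
proof -
  have P: "finite ?P" "?P \<noteq> {}" "card ?P = fact (card (pverts G))"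
    using fin finite_permutations permutes_id card_permutations by blast+
  have w: "(if k < length (mp_chart G)
            then real (mp_chart G ! k) / fact (length (mp_chart G) - 1) else 0)
           = pmf (map_pmf ?X (pmf_of_set ?P)) k" (is "?w k = _") for k
  proof -
    have m: "pmf (map_pmf ?X (pmf_of_set ?P)) k = real (mp_count G k) / fact (card (pverts G))"
      using P by (simp add: pmf_map measure_pmf_of_set mp_count_def vimage_def Int_def)
    have z: "mp_count G k = 0" if "k > card (pverts G)"
    proof -
      have "{\<pi>. \<pi> permutes pverts G \<and> ?X \<pi> = k} = {}"
        using adj_mat_sum_le[OF fin] that by (metis (mono_tags, lifting) Collect_empty_eq not_le)
      then show ?thesis unfolding mp_count_def by (simp only: card.empty)
    qed
    show ?thesis unfolding m using z by (auto simp: mp_chart_def simp del: upt_Suc)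
  qed
  show ?thesis
    unfolding chart_pmf_def w by (rule pmf_eqI) (simp add: pmf_embed_pmf nn_integral_pmf_eq_1)
qed

lemma pmf_chart_pmf:
  assumes fin: "finite (pverts G)"
  shows "pmf (chart_pmf (mp_chart G)) k = real (mp_count G k) / fact (card (pverts G))"
proof -
  have "finite {\<pi>. \<pi> permutes pverts G}" "{\<pi>. \<pi> permutes pverts G} \<noteq> {}"
    "card {\<pi>. \<pi> permutes pverts G} = fact (card (pverts G))"
    using fin finite_permutations permutes_id card_permutations by blast+
  then show ?thesis
    unfolding chart_pmf_eq_map_pmf[OF fin]
    by (simp add: pmf_map measure_pmf_of_set mp_count_def vimage_def Int_def)
qed

lemma pair_graph_graph_complement:
  assumes "pair_graph G"
  shows "pair_graph (graph_complement G)"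
proof -
  interpret pair_graph G by fact
  have "sym (parcs G)" using pair_sym_arcs by (simp add: symmetric_def)
  then have "symmetric (with_proj (graph_complement G))"
    by (auto simp: symmetric_def graph_complement_def sym_def)
  then show ?thesis
    by unfold_locales (auto simp: graph_complement_def)
qed

end

theory Submission
  imports Defs
begin

text \<open>
  Write \<open>X\<close>, \<open>X'\<close> and \<open>F\<close> for the statistic of \<open>G\<close>, the statistic of the complement and the
  number of fixed points, as functions of a uniformly random permutation \<open>\<pi>\<close>. Every pair
  \<open>(i, \<pi> i)\<close> is an arc of \<open>G\<close>, an arc of the complement, or on the diagonal, so
  \<open>X' = N - F - X\<close>. Hence the mean of \<open>X'\<close> follows from \<open>\<bbbE> F = 1\<close>, and
  \<open>Var X' = Var X + Var F + 2 Cov (F, X)\<close> with \<open>Var F = 1\<close>.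

  The covariance is what needs an argument. \<open>F\<close> and \<open>X\<close> are both of the form
  \<open>\<Sum>i. a i (\<pi> i)\<close> for a matrix \<open>a\<close> (the identity and the adjacency matrix), and
  multiplying such a sum by \<open>F\<close> amounts to summing it, for each point \<open>k\<close>, over the permutations
  that fix \<open>k\<close>. These are the permutations of the remaining points, so the first moment formula
  \<open>sum_permutes_matrix\<close> on the points other than \<open>k\<close> yields the weighted formula
  \<open>sum_permutes_fixpoints_matrix\<close>. The weighted formula gives both \<open>\<bbbE> (F\<^sup>2) = 2\<close> and
  \<open>\<bbbE> (F X) = \<bbbE> X (N - 2) / (N - 1)\<close>, that is, \<open>Cov (F, X) = - \<bbbE> X / (N - 1)\<close>.
\<close>

section \<open>Moments of matrix sums along permutations\<close>

lemma permutes_fixing_eq: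
  assumes "k \<in> S"
  shows "{\<pi>. \<pi> permutes S \<and> \<pi> k = k} = {\<pi>. \<pi> permutes (S - {k})}"
  using assms by (auto simp: permutes_def)

text \<open>Composing with the transposition of \<open>i\<close> and \<open>j\<close> turns the condition \<open>\<pi> i = j\<close> into
  fixing \<open>i\<close>.\<close>
lemma card_permutes_mapping:
  assumes "finite S" "i \<in> S" "j \<in> S"
  shows "card {\<pi>. \<pi> permutes S \<and> \<pi> i = j} = fact (card S - 1)"
proof -
  let ?t = "Transposition.transpose i j"
  have t: "?t \<circ> \<pi> permutes S" if "\<pi> permutes S" for \<pi>
    using assms that by (intro permutes_compose permutes_swap_id)
  have "bij_betw (\<lambda>\<pi>. ?t \<circ> \<pi>) {\<pi>. \<pi> permutes S \<and> \<pi> i = j} {\<pi>. \<pi> permutes S \<and> \<pi> i = i}"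
    by (rule bij_betw_byWitness[where f' = "\<lambda>\<pi>. ?t \<circ> \<pi>"])
       (use t in \<open>auto simp: fun_eq_iff\<close>)
  then have "card {\<pi>. \<pi> permutes S \<and> \<pi> i = j} = card {\<pi>. \<pi> permutes (S - {i})}"
    using permutes_fixing_eq[OF assms(2)] by (simp add: bij_betw_same_card)
  also have "\<dots> = fact (card S - 1)"
    using assms by (intro card_permutations) auto
  finally show ?thesis .
qed

lemma sum_permutes_matrix:
  fixes a :: "'a \<Rightarrow> 'a \<Rightarrow> real"
  assumes S: "finite S"
  shows "(\<Sum>\<pi> | \<pi> permutes S. \<Sum>i\<in>S. a i (\<pi> i)) = fact (card S - 1) * (\<Sum>i\<in>S. \<Sum>j\<in>S. a i j)"
proof -
  let ?P = "{\<pi>. \<pi> permutes S}"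
  have P: "finite ?P" using S by (rule finite_permutations)
  have entry: "(\<Sum>\<pi>\<in>?P. a i (\<pi> i)) = (\<Sum>j\<in>S. fact (card S - 1) * a i j)" if i: "i \<in> S" for i
  proof -
    have "(\<Sum>\<pi>\<in>?P. a i (\<pi> i)) = (\<Sum>j\<in>S. \<Sum>\<pi>\<in>{\<pi> \<in> ?P. \<pi> i = j}. a i (\<pi> i))"
      using i by (intro sum.group[symmetric] P S) (auto simp: permutes_in_image)
    also have "\<dots> = (\<Sum>j\<in>S. real (card {\<pi> \<in> ?P. \<pi> i = j}) * a i j)"
      by (intro sum.cong refl) simp
    also have "\<dots> = (\<Sum>j\<in>S. fact (card S - 1) * a i j)"
      using card_permutes_mapping[OF S i] by (intro sum.cong refl) simp
    finally show ?thesis .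
  qed
  have "(\<Sum>\<pi>\<in>?P. \<Sum>i\<in>S. a i (\<pi> i)) = (\<Sum>i\<in>S. \<Sum>\<pi>\<in>?P. a i (\<pi> i))"
    by (rule sum.swap)
  also have "\<dots> = fact (card S - 1) * (\<Sum>i\<in>S. \<Sum>j\<in>S. a i j)"
    by (simp add: entry sum_distrib_left)
  finally show ?thesis .
qed

text \<open>An off-diagonal entry of the matrix survives the removal of every index except its own row
  and column; a diagonal entry survives all removals but one.\<close>
lemma sum_minors:
  fixes a :: "'a \<Rightarrow> 'a \<Rightarrow> real"
  assumes S: "finite S"
  shows "(\<Sum>k\<in>S. \<Sum>i\<in>S-{k}. \<Sum>j\<in>S-{k}. a i j) =
    (real (card S) - 2) * (\<Sum>i\<in>S. \<Sum>j\<in>S. a i j) + (\<Sum>k\<in>S. a k k)"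
proof -
  have minor: "(\<Sum>i\<in>S-{k}. \<Sum>j\<in>S-{k}. a i j) =
      (\<Sum>i\<in>S. \<Sum>j\<in>S. a i j) - (\<Sum>j\<in>S. a k j) - (\<Sum>i\<in>S. a i k) + a k k" if "k \<in> S" for k
    using that S by (simp add: sum_diff1 sum_subtractf)
  have cols: "(\<Sum>k\<in>S. \<Sum>i\<in>S. a i k) = (\<Sum>i\<in>S. \<Sum>j\<in>S. a i j)"
    by (rule sum.swap)
  show ?thesis
    by (simp add: minor sum.distrib sum_subtractf cols algebra_simps)
qed

text \<open>Weighting by the number of fixed points splits the sum according to a marked fixed point
  \<open>k\<close>; the permutations fixing \<open>k\<close> contribute the diagonal entry at \<open>k\<close> and the first moment of
  the matrix with row and column \<open>k\<close> deleted.\<close>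
lemma sum_permutes_fixpoints_matrix:
  fixes a :: "'a \<Rightarrow> 'a \<Rightarrow> real"
  assumes S: "finite S" and two: "card S \<ge> 2"
  shows "(\<Sum>\<pi> | \<pi> permutes S. (\<Sum>k\<in>S. of_bool (k = \<pi> k)) * (\<Sum>i\<in>S. a i (\<pi> i))) =
    fact (card S - 2) *
      (real (card S) * (\<Sum>k\<in>S. a k k) + (real (card S) - 2) * (\<Sum>i\<in>S. \<Sum>j\<in>S. a i j))"
proof -
  let ?P = "{\<pi>. \<pi> permutes S}"
  let ?f = "fact (card S - 2) :: real"
  have P: "finite ?P" using S by (rule finite_permutations)
  have f: "fact (card S - 1) = (real (card S) - 1) * ?f"
    using two by (subst fact_reduce) (auto simp: numeral_2_eq_2 of_nat_diff)
  have marked: "(\<Sum>\<pi>\<in>?P. of_bool (k = \<pi> k) * (\<Sum>i\<in>S. a i (\<pi> i))) =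
      (real (card S) - 1) * ?f * a k k + ?f * (\<Sum>i\<in>S-{k}. \<Sum>j\<in>S-{k}. a i j)"
    if k: "k \<in> S" for k
  proof -
    let ?Q = "{\<pi>. \<pi> permutes (S - {k})}"
    have cards: "card (S - {k}) = card S - 1" "card (S - {k}) - 1 = card S - 2"
      using k S by auto
    have cardQ: "card ?Q = fact (card S - 1)"
      using card_permutations[OF cards(1)] S by simp
    have "(\<Sum>\<pi>\<in>?P. of_bool (k = \<pi> k) * (\<Sum>i\<in>S. a i (\<pi> i))) =
        (\<Sum>\<pi>\<in>{\<pi> \<in> ?P. \<pi> k = k}. \<Sum>i\<in>S. a i (\<pi> i))"
      unfolding sum.inter_filter[OF P] by (intro sum.cong) auto
    also have "{\<pi> \<in> ?P. \<pi> k = k} = ?Q"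
      using permutes_fixing_eq[OF k] by simp
    also have "(\<Sum>\<pi>\<in>?Q. \<Sum>i\<in>S. a i (\<pi> i)) = (\<Sum>\<pi>\<in>?Q. a k k + (\<Sum>i\<in>S-{k}. a i (\<pi> i)))"
      using k S by (intro sum.cong refl) (auto simp: sum.remove permutes_def)
    also have "\<dots> = fact (card S - 1) * a k k + ?f * (\<Sum>i\<in>S-{k}. \<Sum>j\<in>S-{k}. a i j)"
      using sum_permutes_matrix[of "S - {k}" a, unfolded cards(2)] S
      by (simp add: sum.distrib cardQ)
    finally show ?thesis unfolding f .
  qed
  have "(\<Sum>\<pi>\<in>?P. (\<Sum>k\<in>S. of_bool (k = \<pi> k)) * (\<Sum>i\<in>S. a i (\<pi> i))) =
      (\<Sum>k\<in>S. \<Sum>\<pi>\<in>?P. of_bool (k = \<pi> k) * (\<Sum>i\<in>S. a i (\<pi> i)))"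
    unfolding sum_distrib_right by (rule sum.swap)
  also have "\<dots> = (\<Sum>k\<in>S. (real (card S) - 1) * ?f * a k k +
      ?f * (\<Sum>i\<in>S-{k}. \<Sum>j\<in>S-{k}. a i j))"
    by (intro sum.cong refl marked)
  also have "\<dots> = (real (card S) - 1) * ?f * (\<Sum>k\<in>S. a k k) +
      ?f * (\<Sum>k\<in>S. \<Sum>i\<in>S-{k}. \<Sum>j\<in>S-{k}. a i j)"
    by (simp only: sum.distrib sum_distrib_left)
  finally show ?thesis
    unfolding sum_minors[OF S] by (simp add: algebra_simps)
qed

section \<open>Charts of a graph and of its complement\<close>

definition mp_stat :: "'a pair_pre_digraph \<Rightarrow> ('a \<Rightarrow> 'a) \<Rightarrow> real" where
  "mp_stat G \<pi> = (\<Sum>i\<in>pverts G. real (adj_mat G i (\<pi> i)))"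

lemma expectation_chart_pmf:
  fixes f :: "real \<Rightarrow> real"
  assumes "finite (pverts G)"
  shows "measure_pmf.expectation (chart_pmf (mp_chart G)) (\<lambda>k. f (real k)) =
    (\<Sum>\<pi> | \<pi> permutes pverts G. f (mp_stat G \<pi>)) / fact (card (pverts G))"
proof -
  have "finite {\<pi>. \<pi> permutes pverts G}" "{\<pi>. \<pi> permutes pverts G} \<noteq> {}"
    using assms finite_permutations permutes_id by blast+
  then show ?thesis
    using assms
    by (simp add: chart_pmf_eq_map_pmf integral_pmf_of_set mp_stat_def
        card_permutations[OF refl])
qed

lemma chart_mean_eq:
  assumes "finite (pverts G)"
  shows "chart_mean (mp_chart G) =
    (\<Sum>\<pi> | \<pi> permutes pverts G. mp_stat G \<pi>) / fact (card (pverts G))"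
  using expectation_chart_pmf[OF assms, of "\<lambda>x. x"] by (simp add: chart_mean_def)

lemma chart_variance_eq:
  assumes fin: "finite (pverts G)"
  shows "chart_variance (mp_chart G) =
    (\<Sum>\<pi> | \<pi> permutes pverts G. (mp_stat G \<pi>)\<^sup>2) / fact (card (pverts G)) -
    (chart_mean (mp_chart G))\<^sup>2"
proof -
  have "{\<pi>. \<pi> permutes pverts G} \<noteq> {}"
    using permutes_id by blast
  then have "finite (set_pmf (chart_pmf (mp_chart G)))"
    using finite_permutations[OF fin] by (simp add: chart_pmf_eq_map_pmf[OF fin])
  then have "chart_variance (mp_chart G) =
      measure_pmf.expectation (chart_pmf (mp_chart G)) (\<lambda>k. (real k)\<^sup>2) -
      (chart_mean (mp_chart G))\<^sup>2"
    unfolding chart_variance_def chart_mean_def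
    by (intro measure_pmf.variance_eq integrable_measure_pmf_finite)
  then show ?thesis
    using expectation_chart_pmf[OF fin, of "\<lambda>x. x\<^sup>2"] by simp
qed

lemma mp_stat_complement:
  assumes loopfree: "\<And>v. (v, v) \<notin> parcs G"
    and \<pi>: "\<pi> permutes pverts G"
  shows "mp_stat (graph_complement G) \<pi> =
    real (card (pverts G)) - (\<Sum>k\<in>pverts G. of_bool (k = \<pi> k)) - mp_stat G \<pi>"
proof -
  have "real (adj_mat (graph_complement G) i (\<pi> i)) =
      1 - of_bool (i = \<pi> i) - real (adj_mat G i (\<pi> i))" if i: "i \<in> pverts G" for i
  proof -
    have "\<pi> i \<in> pverts G"
      using i \<pi> by (simp add: permutes_in_image)
    then show ?thesis
      using i loopfree[of i] by (auto simp: adj_mat_def graph_complement_def Id_on_def)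
  qed
  moreover have "pverts (graph_complement G) = pverts G"
    by (simp add: graph_complement_def)
  ultimately show ?thesis
    by (simp add: mp_stat_def sum_subtractf)
qed

theorem theorem4p4:
  fixes G :: "nat pair_pre_digraph" and N :: nat
  assumes "pair_graph G" and "pverts G = {1..N}" and "N \<ge> 2"
  shows "chart_mean (mp_chart (graph_complement G)) = real N - 1 - chart_mean (mp_chart G) \<and>
         chart_variance (mp_chart (graph_complement G)) =
           chart_variance (mp_chart G) + 1 - 2 * chart_mean (mp_chart G) / (real N - 1)"
proof -
  interpret pair_graph G by fact
  let ?V = "pverts G"
  let ?P = "{\<pi>. \<pi> permutes ?V}"
  define n where "n = real N"
  define p where "p = (fact N :: real)"
  define X where "X = mp_stat G"
  define F where "F = (\<lambda>\<pi>. \<Sum>k\<in>?V. of_bool (k = \<pi> k) :: real)"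
  define m where "m = (\<Sum>i\<in>?V. \<Sum>j\<in>?V. real (adj_mat G i j))"
  have V: "finite ?V" "card ?V = N"
    using assms(2) by auto
  have n: "n \<ge> 2" and p: "p > 0"
    using assms(3) by (auto simp: n_def p_def)
  have cardP: "real (card ?P) = p"
    using V by (simp add: card_permutations p_def)
  have loopfree: "(v, v) \<notin> parcs G" for v
    using no_loops[of "(v, v)"] by auto
  have f1: "fact (N - Suc 0) = p / n"
    using assms(3) by (simp add: p_def n_def fact_reduce[of N])
  have f2: "fact (N - 2) = p / (n * (n - 1))"
  proof -
    have "(fact (N - 1) :: real) = (n - 1) * fact (N - 2)"
      using assms(3) by (subst fact_reduce) (auto simp: n_def numeral_2_eq_2 of_nat_diff)
    then have "p / n = (n - 1) * fact (N - 2)"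
      by (simp only: f1 One_nat_def)
    then have "p / n / (n - 1) = fact (N - 2)"
      using n by simp
    then show ?thesis by simp
  qed

  have idm: "(\<Sum>i\<in>?V. \<Sum>j\<in>?V. of_bool (i = j)) = n"
    using V by (simp add: of_bool_def n_def)
  have diag: "(\<Sum>k\<in>?V. real (adj_mat G k k)) = 0"
    by (simp add: adj_mat_def loopfree)
  have EF: "(\<Sum>\<pi>\<in>?P. F \<pi>) = p"
    using sum_permutes_matrix[OF V(1), of "\<lambda>i j. of_bool (i = j)"] idm n
    by (simp add: F_def V f1)
  have EX: "(\<Sum>\<pi>\<in>?P. X \<pi>) = p * (m / n)"
    using sum_permutes_matrix[OF V(1), of "\<lambda>i j. real (adj_mat G i j)"]
    by (simp add: X_def mp_stat_def m_def V f1)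
  have EFF: "(\<Sum>\<pi>\<in>?P. F \<pi> * F \<pi>) = 2 * p"
  proof -
    have "(\<Sum>\<pi>\<in>?P. F \<pi> * F \<pi>) = p / (n * (n - 1)) * (n * n + (n - 2) * n)"
      using sum_permutes_fixpoints_matrix[OF V(1), of "\<lambda>i j. of_bool (i = j)"] idm assms(3)
      by (simp add: F_def V f2 flip: n_def)
    also have "n * n + (n - 2) * n = 2 * (n * (n - 1))"
      by (simp add: algebra_simps)
    also have "p / (n * (n - 1)) * (2 * (n * (n - 1))) = 2 * p"
      using n by (simp add: field_simps)
    finally show ?thesis .
  qed
  have EFX: "(\<Sum>\<pi>\<in>?P. F \<pi> * X \<pi>) = p * (m / n - m / n / (n - 1))"
  proof -
    have "(\<Sum>\<pi>\<in>?P. F \<pi> * X \<pi>) = p / (n * (n - 1)) * ((n - 2) * m)"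
      using sum_permutes_fixpoints_matrix[OF V(1), of "\<lambda>i j. real (adj_mat G i j)"] diag assms(3)
      by (simp add: F_def X_def mp_stat_def m_def V f2 flip: n_def)
    also have "\<dots> = p * (m / n - m / n / (n - 1))"
      using n by (simp add: field_simps)
    finally show ?thesis .
  qed

  let ?C = "graph_complement G"
  have vC: "pverts ?C = ?V"
    by (simp add: graph_complement_def)
  have XC: "mp_stat ?C \<pi> = n - F \<pi> - X \<pi>" if "\<pi> \<in> ?P" for \<pi>
    using mp_stat_complement[OF loopfree, of \<pi>] that by (simp add: F_def X_def V n_def)
  have mean: "chart_mean (mp_chart G) = m / n"
    using p by (simp add: chart_mean_eq V EX flip: p_def X_def)
  have "chart_mean (mp_chart ?C) = (\<Sum>\<pi>\<in>?P. n - F \<pi> - X \<pi>) / p"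
    using XC by (simp add: chart_mean_eq vC V p_def)
  also have "\<dots> = (p * n - p - p * (m / n)) / p"
    by (simp add: sum_subtractf EF EX cardP)
  also have "\<dots> = n - 1 - m / n"
    using p by (simp add: diff_divide_distrib)
  finally have meanC: "chart_mean (mp_chart ?C) = n - 1 - m / n" .

  define s where "s = (\<Sum>\<pi>\<in>?P. (X \<pi>)\<^sup>2) / p"
  have var: "chart_variance (mp_chart G) = s - (m / n)\<^sup>2"
    by (simp add: chart_variance_eq V mean s_def flip: p_def X_def)
  have "(\<Sum>\<pi>\<in>?P. (mp_stat ?C \<pi>)\<^sup>2) =
      (\<Sum>\<pi>\<in>?P. n\<^sup>2 - 2 * n * F \<pi> - 2 * n * X \<pi> + F \<pi> * F \<pi> + 2 * (F \<pi> * X \<pi>) + (X \<pi>)\<^sup>2)"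
    by (intro sum.cong refl) (simp add: XC power2_eq_square algebra_simps)
  also have "\<dots> = p * n\<^sup>2 - 2 * n * p - 2 * n * (p * (m / n)) + 2 * p
      + 2 * (p * (m / n - m / n / (n - 1))) + p * s"
    using p by (simp add: sum.distrib sum_subtractf EF EX EFF EFX cardP s_def
        flip: sum_distrib_left)
  also have "\<dots> = p * (n\<^sup>2 - 2 * n - 2 * n * (m / n) + 2 + 2 * (m / n - m / n / (n - 1)) + s)"
    by (simp only: distrib_left right_diff_distrib mult_ac)
  finally have "(\<Sum>\<pi>\<in>?P. (mp_stat ?C \<pi>)\<^sup>2) / p =
      n\<^sup>2 - 2 * n - 2 * n * (m / n) + 2 + 2 * (m / n - m / n / (n - 1)) + s"
    using p by simp
  then have varC: "chart_variance (mp_chart ?C) =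
      n\<^sup>2 - 2 * n - 2 * n * (m / n) + 2 + 2 * (m / n - m / n / (n - 1)) + s - (n - 1 - m / n)\<^sup>2"
    by (simp add: chart_variance_eq vC V meanC flip: p_def)
  (* The mean e and its quotient by n - 1 are generalised, which leaves a polynomial identity. *)
  have "n\<^sup>2 - 2 * n - 2 * n * e + 2 + 2 * (e - q) + s - (n - 1 - e)\<^sup>2 = s - e\<^sup>2 + 1 - 2 * q"
    for e q :: real
    by (simp add: power2_eq_square algebra_simps)
  from this[of "m / n" "m / n / (n - 1)"] show ?thesis
    unfolding varC meanC var mean by (simp add: n_def)
qed

end
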